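(* Let $X$ be a zero-dimensional metric space with derived set $X'$. Then the following assertions are equivalent: (i) $C_k(X,2)$ is normal; (ii) $C_p(X,2)$ is normal; (iii) $C_k(X,2)$ is Lindelöf; (iv) $X'$ is separable.
   Context: Zero-dimensional means having a base of clopen sets. The derived set $X'$ is the set of all non-isolated points of $X$. $2=\{0,1\}$ is the two-point discrete space. $C_k(X,2)$ (respectively $C_p(X,2)$) is the set of continuous functions $X\to 2$ with the compact-open topology (respectively the topology of pointwise convergence). *)

theory Defs
  imports "HOL-Analysis.Analysis"
begin

definition zero_dimensional_space :: "'a topology \<Rightarrow> bool" where
  "zero_dimensional_space X \<longleftrightarrow>
     (\<exists>\<B>. (\<forall>B\<in>\<B>. openin X B \<and> closedin X B) \<and>
          openin X = arbitrary union_of (\<lambda>B. B \<in> \<B>))"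

text \<open>Continuous maps are represented by functions that are \<^term>\<open>undefined\<close> off
  \<^term>\<open>topspace X\<close>, so that equality in HOL is equality as maps on the space.\<close>

definition cfuns :: "'a topology \<Rightarrow> 'b topology \<Rightarrow> ('a \<Rightarrow> 'b) set" where
  "cfuns X Y = {f \<in> extensional (topspace X). continuous_map X Y f}"

definition Cp :: "'a topology \<Rightarrow> 'b topology \<Rightarrow> ('a \<Rightarrow> 'b) topology" where
  "Cp X Y = subtopology (product_topology (\<lambda>_. Y) (topspace X)) (cfuns X Y)"

text \<open>The sets below form a subbase. Taking \<open>K = {}\<close> gives the whole of \<^term>\<open>cfuns X Y\<close>,
  which is therefore the underlying set of the generated topology.\<close>

definition Ck :: "'a topology \<Rightarrow> 'b topology \<Rightarrow> ('a \<Rightarrow> 'b) topology" where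
  "Ck X Y = topology_generated_by
     {{f \<in> cfuns X Y. f ` K \<subseteq> U} | K U. compactin X K \<and> openin Y U}"

definition two :: "nat topology" where
  "two = discrete_topology {0, 1}"

end

theory Submission
  imports Defs
begin

text \<open>If the derived set \<open>X'\<close> is separable, it has a countable outer base in \<open>X\<close>. Given a map \<open>f\<close>, the
  members of that base on which \<open>f\<close> is constantly 0 or constantly 1 cover \<open>X'\<close>, so prescribing these values
  leaves only isolated points free and the maps with these values form a compact subset of \<open>Ck X two\<close>,
  a copy of a power of \<open>{0, 1}\<close>. Every neighbourhood of this compact set contains all
  maps that satisfy finitely many of the prescriptions, and there are only countably many finite families
  of prescriptions; hence \<open>Ck X two\<close> is Lindelof, and being regular it is normal, as is its coarser
  companion \<open>Cp X two\<close>.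

  If \<open>X'\<close> is not separable, it contains an uncountable uniformly separated set \<open>E\<close>. Shrinking clopen
  neighbourhoods of the points of \<open>E\<close> make the power of the discrete space \<open>\<nat>\<close> with exponent \<open>E\<close>
  a retract of both function spaces, and by a theorem of A. H. Stone this power is not normal.\<close>

section \<open>Open sets in a power of a discrete space, through agreement on finitely many
  coordinates\<close>

lemma openin_product_discrete_topology:
  "openin (product_topology (\<lambda>_. discrete_topology D) E) W \<longleftrightarrow>
     W \<subseteq> (E \<rightarrow>\<^sub>E D) \<and>
     (\<forall>f\<in>W. \<exists>F. finite F \<and> F \<subseteq> E \<and>
        (\<forall>g\<in>E \<rightarrow>\<^sub>E D. (\<forall>i\<in>F. g i = f i) \<longrightarrow> g \<in> W))"
  (is "?L \<longleftrightarrow> ?R")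
proof
  assume L: ?L
  have "\<exists>F. finite F \<and> F \<subseteq> E \<and> (\<forall>g\<in>E \<rightarrow>\<^sub>E D. (\<forall>i\<in>F. g i = f i) \<longrightarrow> g \<in> W)"
    if "f \<in> W" for f
  proof -
    obtain U where U: "finite {i \<in> E. U i \<noteq> D}" "f \<in> Pi\<^sub>E E U" "Pi\<^sub>E E U \<subseteq> W"
      using L \<open>f \<in> W\<close> unfolding openin_product_topology_alt by fastforce
    have "g \<in> W" if "g \<in> E \<rightarrow>\<^sub>E D" "\<forall>i\<in>{i \<in> E. U i \<noteq> D}. g i = f i" for g
    proof -
      have "g i \<in> U i" if "i \<in> E" for i
        using that \<open>g \<in> E \<rightarrow>\<^sub>E D\<close> \<open>\<forall>i\<in>{i \<in> E. U i \<noteq> D}. g i = f i\<close> PiE_mem[OF U(2) that]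
        by (cases "U i = D") auto
      then have "g \<in> Pi\<^sub>E E U"
        using \<open>g \<in> E \<rightarrow>\<^sub>E D\<close> by (simp add: PiE_iff)
      then show ?thesis
        using U(3) by blast
    qed
    then show ?thesis
      using U(1) by (intro exI[of _ "{i \<in> E. U i \<noteq> D}"] conjI ballI impI) auto
  qed
  moreover have "W \<subseteq> (E \<rightarrow>\<^sub>E D)"
    using openin_subset[OF L] by simp
  ultimately show ?R by blast
next
  assume R: ?R
  have "\<exists>U. finite {i \<in> E. U i \<noteq> D} \<and> (\<forall>i\<in>E. U i \<subseteq> D) \<and> f \<in> Pi\<^sub>E E U \<and> Pi\<^sub>E E U \<subseteq> W"
    if f: "f \<in> W" for f
  proof -
    obtain F where F: "finite F" "F \<subseteq> E" "\<forall>g\<in>E \<rightarrow>\<^sub>E D. (\<forall>i\<in>F. g i = f i) \<longrightarrow> g \<in> W"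
      using bspec[OF conjunct2[OF R] f] by (elim exE conjE)
    define U where "U = (\<lambda>i. if i \<in> F then {f i} else D)"
    have fD: "f \<in> E \<rightarrow>\<^sub>E D"
      using R f by blast
    have "finite {i \<in> E. U i \<noteq> D}"
      by (rule finite_subset[OF _ F(1)]) (auto simp: U_def)
    moreover have UD: "\<forall>i\<in>E. U i \<subseteq> D"
      using PiE_mem[OF fD] by (simp add: U_def)
    moreover have "f \<in> Pi\<^sub>E E U"
      using PiE_mem[OF fD] fD unfolding PiE_iff by (simp add: U_def)
    moreover have "g \<in> W" if g: "g \<in> Pi\<^sub>E E U" for g
    proof (rule F(3)[rule_format])
      show "g \<in> E \<rightarrow>\<^sub>E D"
        using g UD unfolding PiE_iff by blast
      show "g i = f i" if "i \<in> F" for i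
        using PiE_mem[OF g, of i] F(2) that by (auto simp: U_def)
    qed
    ultimately show ?thesis by (intro exI[of _ U]) blast
  qed
  then show ?L
    unfolding openin_product_topology_alt by simp
qed

subsection \<open>Spaces of two-valued maps\<close>

lemma cfuns_two_range: "f \<in> cfuns X two \<Longrightarrow> x \<in> topspace X \<Longrightarrow> f x = 0 \<or> f x = 1"
  by (force simp: cfuns_def two_def continuous_map_def)

lemma openin_cfuns_two_fibre:
  assumes "f \<in> cfuns X two"
  shows "openin X {x \<in> topspace X. f x = i}"
proof -
  \<comment> \<open>Intersecting with \<open>{0, 1}\<close> gives an open set of \<open>two\<close>
    for every natural number \<open>i\<close>, also when the fibre is empty.\<close>
  have "openin X {x \<in> topspace X. f x \<in> {i} \<inter> {0, 1}}"
    using assms by (intro openin_continuous_map_preimage[of X two]) (auto simp: cfuns_def two_def)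
  moreover have "{x \<in> topspace X. f x \<in> {i} \<inter> {0, 1}} = {x \<in> topspace X. f x = i}"
    using cfuns_two_range[OF assms] by auto
  ultimately show ?thesis by simp
qed

lemma cfuns_twoI:
  assumes "f \<in> extensional (topspace X)" and "\<And>x. x \<in> topspace X \<Longrightarrow> f x = 0 \<or> f x = 1"
    and op: "openin X {x \<in> topspace X. f x = 0}" "openin X {x \<in> topspace X. f x = 1}"
  shows "f \<in> cfuns X two"
proof -
  have "openin X {x \<in> topspace X. f x \<in> U}" if "U \<subseteq> {0, 1}" for U
  proof -
    have "{x \<in> topspace X. f x \<in> U} = (\<Union>i\<in>U. {x \<in> topspace X. f x = i})"
      by auto
    then show ?thesis
      using that op by (auto intro!: openin_clauses(3))
  qed
  then show ?thesis
    using assms(1,2) by (auto simp: cfuns_def two_def continuous_map_def)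
qed

lemma cfuns_two_subset_PiE: "cfuns X two \<subseteq> topspace X \<rightarrow>\<^sub>E {0, 1}"
proof
  fix f assume "f \<in> cfuns X two"
  then show "f \<in> topspace X \<rightarrow>\<^sub>E {0, 1}"
    using cfuns_two_range[of f X] unfolding PiE_iff cfuns_def by blast
qed

lemma topspace_Cp [simp]: "topspace (Cp X two) = cfuns X two"
  using cfuns_two_subset_PiE[of X] unfolding Cp_def by (simp add: two_def Int_absorb1)

lemma topspace_Ck [simp]: "topspace (Ck X two) = cfuns X two"
proof -
  have "cfuns X two \<in> {{f \<in> cfuns X two. f ` K \<subseteq> U} | K U. compactin X K \<and> openin two U}"
    by (rule CollectI, rule exI[of _ "{}"], rule exI[of _ "{}"]) auto
  then show ?thesis
    unfolding Ck_def topology_generated_by_topspace by blast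
qed

text \<open>As \<open>two\<close> is discrete, basic neighbourhoods in the product fix the values at
  finitely many points. The description of \<open>Ck\<close> below has the same form with compact
  sets, so the two topologies can be compared directly.\<close>

lemma openin_Cp_two_iff:
  "openin (Cp X two) W \<longleftrightarrow>
     W \<subseteq> cfuns X two \<and>
     (\<forall>f\<in>W. \<exists>F. finite F \<and> F \<subseteq> topspace X \<and>
        (\<forall>g\<in>cfuns X two. (\<forall>x\<in>F. g x = f x) \<longrightarrow> g \<in> W))"
  (is "?L \<longleftrightarrow> ?R")
proof
  assume ?L
  then obtain T where "openin (product_topology (\<lambda>_. two) (topspace X)) T" and W: "W = T \<inter> cfuns X two"
    unfolding Cp_def openin_subtopology by blast
  then have T: "\<forall>f\<in>T. \<exists>F. finite F \<and> F \<subseteq> topspace X \<and>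
        (\<forall>g\<in>topspace X \<rightarrow>\<^sub>E {0,1}. (\<forall>i\<in>F. g i = f i) \<longrightarrow> g \<in> T)"
    unfolding two_def openin_product_discrete_topology by blast
  show ?R
    using T cfuns_two_subset_PiE[of X] unfolding W by (metis (no_types, lifting) Int_iff inf_le2 subsetD)
next
  assume R: ?R
  \<comment> \<open>\<open>T\<close> is the union of the cylinders of the full product that are
    centred in \<open>W\<close> and whose trace on \<open>cfuns X two\<close> lies in
    \<open>W\<close>.\<close>
  define T where "T = {g \<in> topspace X \<rightarrow>\<^sub>E {0,1}. \<exists>f\<in>W. \<exists>F. finite F \<and> F \<subseteq> topspace X \<and>
        (\<forall>x\<in>F. g x = f x) \<and> (\<forall>g\<in>cfuns X two. (\<forall>x\<in>F. g x = f x) \<longrightarrow> g \<in> W)}"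
  have "openin (product_topology (\<lambda>_. two) (topspace X)) T"
    unfolding two_def openin_product_discrete_topology
  proof (intro conjI ballI)
    fix g assume "g \<in> T"
    then obtain f F where F: "f \<in> W" "finite F" "F \<subseteq> topspace X" "\<forall>x\<in>F. g x = f x"
      "\<forall>g\<in>cfuns X two. (\<forall>x\<in>F. g x = f x) \<longrightarrow> g \<in> W"
      by (auto simp: T_def)
    then have "\<forall>h\<in>topspace X \<rightarrow>\<^sub>E {0,1}. (\<forall>i\<in>F. h i = g i) \<longrightarrow> h \<in> T"
      unfolding T_def by force
    then show "\<exists>F. finite F \<and> F \<subseteq> topspace X \<and>
        (\<forall>h\<in>topspace X \<rightarrow>\<^sub>E {0,1}. (\<forall>i\<in>F. h i = g i) \<longrightarrow> h \<in> T)"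
      using F by blast
  qed (auto simp: T_def)
  moreover have "W = T \<inter> cfuns X two"
  proof
    show "W \<subseteq> T \<inter> cfuns X two"
    proof
      fix f assume "f \<in> W"
      then have "f \<in> cfuns X two" and "f \<in> topspace X \<rightarrow>\<^sub>E {0,1}"
        using R cfuns_two_subset_PiE[of X] by blast+
      then show "f \<in> T \<inter> cfuns X two"
        using R \<open>f \<in> W\<close> unfolding T_def by (intro IntI CollectI conjI bexI[of _ f]) auto
    qed
  qed (auto simp: T_def)
  ultimately show ?L
    unfolding Cp_def openin_subtopology by blast
qed

text \<open>A finite intersection of subbasic sets is controlled by the union of the compact sets
  involved. Conversely, the two fibres of \<open>f\<close> are clopen and cut \<open>K\<close> into
  two compact pieces, so agreement with \<open>f\<close> on \<open>K\<close> amounts to two subbasic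
  conditions.\<close>

lemma openin_Ck_two_iff:
  "openin (Ck X two) W \<longleftrightarrow>
     W \<subseteq> cfuns X two \<and>
     (\<forall>f\<in>W. \<exists>K. compactin X K \<and>
        (\<forall>g\<in>cfuns X two. (\<forall>x\<in>K. g x = f x) \<longrightarrow> g \<in> W))"
  (is "?L \<longleftrightarrow> ?R")
proof
  assume L: ?L
  have "\<exists>K. compactin X K \<and> (\<forall>g\<in>cfuns X two. (\<forall>x\<in>K. g x = f x) \<longrightarrow> g \<in> W)" if "f \<in> W" for f
    using L[unfolded Ck_def openin_topology_generated_by_iff] that
  proof (induction arbitrary: f rule: generate_topology_on.induct)
    case (Int a b)
    obtain K where K: "compactin X K" "\<forall>g\<in>cfuns X two. (\<forall>x\<in>K. g x = f x) \<longrightarrow> g \<in> a"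
      using Int.IH(1)[of f] Int.prems by blast
    obtain L where L: "compactin X L" "\<forall>g\<in>cfuns X two. (\<forall>x\<in>L. g x = f x) \<longrightarrow> g \<in> b"
      using Int.IH(2)[of f] Int.prems by blast
    from K L show ?case
      by (intro exI[of _ "K \<union> L"]) (auto intro: compactin_Un)
  next
    case (UN \<K>)
    then obtain k where k: "k \<in> \<K>" "f \<in> k" by blast
    then obtain K where "compactin X K" "\<forall>g\<in>cfuns X two. (\<forall>x\<in>K. g x = f x) \<longrightarrow> g \<in> k"
      using UN.IH[of k f] by blast
    then show ?case
      using k by blast
  next
    case (Basis s)
    then obtain K U where K: "compactin X K" "s = {f \<in> cfuns X two. f ` K \<subseteq> U}"
      by blast
    then show ?case
      using Basis by (intro exI[of _ K]) (auto simp: image_subset_iff)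
  qed auto
  moreover have "W \<subseteq> cfuns X two"
    using openin_subset[OF L] by simp
  ultimately show ?R by blast
next
  assume R: ?R
  have "\<exists>T. openin (Ck X two) T \<and> f \<in> T \<and> T \<subseteq> W" if "f \<in> W" for f
  proof -
    obtain K where K: "compactin X K" "\<forall>g\<in>cfuns X two. (\<forall>x\<in>K. g x = f x) \<longrightarrow> g \<in> W"
      using R \<open>f \<in> W\<close> by blast
    have f: "f \<in> cfuns X two"
      using R \<open>f \<in> W\<close> by blast
    \<comment> \<open>\<open>T i\<close> handles the piece of \<open>K\<close> where
      \<open>f\<close> takes the value \<open>i\<close>; \<open>T 0 \<inter> T 1\<close> consists of
      the maps that agree with \<open>f\<close> on all of \<open>K\<close>.\<close>
    define T where "T i = {g \<in> cfuns X two. g ` (K \<inter> {x \<in> topspace X. f x = i}) \<subseteq> {i}}" for i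
    have "openin (Ck X two) (T i)" if "i \<in> {0,1}" for i
    proof -
      \<comment> \<open>\<open>1 - i\<close> exchanges 0 and 1, so each fibre is closed as the
        complement of the other, open one.\<close>
      have "{x \<in> topspace X. f x = i} = topspace X - {x \<in> topspace X. f x = 1 - i}"
        using that cfuns_two_range[OF f] by fastforce
      then have "closedin X {x \<in> topspace X. f x = i}"
        using openin_cfuns_two_fibre[OF f, of "1 - i"] by (metis closedin_diff closedin_topspace)
      then have "compactin X (K \<inter> {x \<in> topspace X. f x = i})"
        using K(1) by (rule compact_Int_closedin[rotated])
      moreover have "openin two {i}"
        using that by (simp add: two_def)
      ultimately show ?thesis
        unfolding Ck_def T_def by (intro topology_generated_by_Basis) blast
    qed
    then have "openin (Ck X two) (T 0 \<inter> T 1)"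
      by auto
    moreover have "f \<in> T 0 \<inter> T 1"
      using f by (auto simp: T_def)
    moreover have "T 0 \<inter> T 1 \<subseteq> W"
    proof
      fix g assume g: "g \<in> T 0 \<inter> T 1"
      have "g x = f x" if "x \<in> K" for x
        using g cfuns_two_range[OF f, of x] that compactin_subset_topspace[OF K(1)]
        unfolding T_def image_subset_iff by force
      then show "g \<in> W"
        using K(2) g by (auto simp: T_def)
    qed
    ultimately show ?thesis by blast
  qed
  then show ?L
    using openin_subopen by blast
qed

lemma continuous_map_Ck_Cp: "continuous_map (Ck X two) (Cp X two) (\<lambda>f. f)"
proof -
  have "openin (Ck X two) W" if "openin (Cp X two) W" for W
    using that unfolding openin_Cp_two_iff openin_Ck_two_iff
    by (meson finite_imp_compactin)
  moreover have "{f \<in> cfuns X two. f \<in> W} = W" if "openin (Cp X two) W" for W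
    using openin_subset[OF that] by auto
  ultimately show ?thesis
    by (simp add: continuous_map_def)
qed

section \<open>Regularity of both function spaces\<close>

lemma regular_space_Cp_two: "regular_space (Cp X two)"
  unfolding Cp_def two_def
  by (intro regular_space_subtopology) (simp add: regular_space_product_topology)

lemma openin_Ck_two_agree:
  assumes "compactin X K"
  shows "openin (Ck X two) {g \<in> cfuns X two. \<forall>x\<in>K. g x = f x}"
  unfolding openin_Ck_two_iff using assms by force

lemma closedin_Ck_two_agree:
  assumes "compactin X K"
  shows "closedin (Ck X two) {g \<in> cfuns X two. \<forall>x\<in>K. g x = f x}"
proof -
  \<comment> \<open>A disagreement of \<open>h\<close> with \<open>f\<close> at a point of
    \<open>K\<close> is shared by every map that agrees with \<open>h\<close> on \<open>K\<close>,
    so the same \<open>K\<close> serves.\<close>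
  have "openin (Ck X two) (cfuns X two - {g \<in> cfuns X two. \<forall>x\<in>K. g x = f x})"
    unfolding openin_Ck_two_iff
  proof (intro conjI ballI)
    fix h assume "h \<in> cfuns X two - {g \<in> cfuns X two. \<forall>x\<in>K. g x = f x}"
    then show "\<exists>L. compactin X L \<and> (\<forall>g\<in>cfuns X two. (\<forall>x\<in>L. g x = h x) \<longrightarrow>
        g \<in> cfuns X two - {g \<in> cfuns X two. \<forall>x\<in>K. g x = f x})"
      by (intro exI[of _ K]) (use assms in auto)
  qed auto
  then show ?thesis
    by (auto simp: closedin_def)
qed

text \<open>Agreement with \<open>f\<close> on a compact set is both an open and a closed condition,
  so every point has a base of closed neighbourhoods.\<close>

lemma regular_space_Ck_two: "regular_space (Ck X two)"
  unfolding neighbourhood_base_of_closedin[symmetric] neighbourhood_base_of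
proof (intro allI impI)
  fix W f assume W: "openin (Ck X two) W \<and> f \<in> W"
  then obtain K where K: "compactin X K" "\<forall>g\<in>cfuns X two. (\<forall>x\<in>K. g x = f x) \<longrightarrow> g \<in> W"
    unfolding openin_Ck_two_iff by blast
  let ?N = "{g \<in> cfuns X two. \<forall>x\<in>K. g x = f x}"
  have "f \<in> ?N" "?N \<subseteq> W"
    using W K(2) openin_subset[of "Ck X two" W] by auto
  then show "\<exists>U V. openin (Ck X two) U \<and> closedin (Ck X two) V \<and> f \<in> U \<and> U \<subseteq> V \<and> V \<subseteq> W"
    using openin_Ck_two_agree[OF K(1)] closedin_Ck_two_agree[OF K(1)] by blast
qed


subsection \<open>The Lindelof property\<close>

text \<open>Singletons of isolated points are open and join \<open>\<S>\<close> in one open cover.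
  Thus a compact set is controlled by finitely many members of \<open>\<S>\<close> and finitely many
  isolated points; the latter become the coordinates of a neighbourhood in a power of
  \<open>{0, 1}\<close>.\<close>

lemma compactin_cover_isolated:
  assumes K: "compactin X K" and op: "\<And>B. B \<in> \<S> \<Longrightarrow> openin X B"
    and iso: "\<And>x. x \<in> R \<Longrightarrow> openin X {x}" and cov: "K \<subseteq> \<Union>\<S> \<union> R"
  shows "\<exists>\<T> F. finite \<T> \<and> \<T> \<subseteq> \<S> \<and> finite F \<and> F \<subseteq> R \<and> K \<subseteq> \<Union>\<T> \<union> F"
proof -
  have "\<exists>\<F>. finite \<F> \<and> \<F> \<subseteq> \<S> \<union> (\<lambda>x. {x}) ` R \<and> K \<subseteq> \<Union>\<F>"
    by (rule compactinD[OF K]) (use op iso cov in auto)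
  then obtain \<F> where \<F>: "finite \<F>" "\<F> \<subseteq> \<S> \<union> (\<lambda>x. {x}) ` R" "K \<subseteq> \<Union>\<F>"
    by blast
  show ?thesis
  proof (intro exI conjI)
    show "finite (\<F> \<inter> \<S>)" "\<F> \<inter> \<S> \<subseteq> \<S>"
      using \<F>(1) by auto
    have "(\<lambda>x. {x}) ` {x \<in> R. {x} \<in> \<F>} \<subseteq> \<F>"
      by auto
    then show "finite {x \<in> R. {x} \<in> \<F>}"
      using \<F>(1) by (metis (no_types, lifting) finite_imageD finite_subset inj_on_def singleton_inject)
    show "{x \<in> R. {x} \<in> \<F>} \<subseteq> R" by auto
    show "K \<subseteq> \<Union>(\<F> \<inter> \<S>) \<union> {x \<in> R. {x} \<in> \<F>}"
    proof
      fix x assume "x \<in> K"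
      then obtain B where "B \<in> \<F>" "x \<in> B"
        using \<F>(3) by blast
      then show "x \<in> \<Union>(\<F> \<inter> \<S>) \<union> {x \<in> R. {x} \<in> \<F>}"
        using \<F>(2) by auto
    qed
  qed
qed

text \<open>Imposes the prescribed values 0 and 1 on \<open>h\<close>. It serves to parametrize the
  maps with prescribed values by their free part, and later to force a prescription on a given map.
  The sets are disjoint wherever continuity is claimed, so the order of the two tests is immaterial
  there.\<close>

definition patch :: "'a topology \<Rightarrow> 'a set \<Rightarrow> 'a set \<Rightarrow> ('a \<Rightarrow> nat) \<Rightarrow> 'a \<Rightarrow> nat" where
  "patch X A\<^sub>0 A\<^sub>1 h = (\<lambda>x\<in>topspace X. if x \<in> A\<^sub>0 then 0 else if x \<in> A\<^sub>1 then 1 else h x)"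

text \<open>Every set of the remaining points is open, since these are isolated; hence
  \<open>h\<close> needs no continuity there.\<close>

lemma patch_in_cfuns:
  assumes "openin X A\<^sub>0" "openin X A\<^sub>1" "disjnt A\<^sub>0 A\<^sub>1"
    and iso: "\<And>x. x \<in> topspace X - A\<^sub>0 - A\<^sub>1 \<Longrightarrow> openin X {x}"
    and h: "\<And>x. x \<in> topspace X - A\<^sub>0 - A\<^sub>1 \<Longrightarrow> h x = 0 \<or> h x = 1"
  shows "patch X A\<^sub>0 A\<^sub>1 h \<in> cfuns X two"
proof (rule cfuns_twoI)
  let ?R = "topspace X - A\<^sub>0 - A\<^sub>1"
  have sub: "A\<^sub>0 \<subseteq> topspace X" "A\<^sub>1 \<subseteq> topspace X"
    using assms(1,2) by (auto dest: openin_subset)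
  have iso': "openin X {x \<in> ?R. h x = i}" for i
    by (subst openin_subopen) (use iso in blast)
  have "{x \<in> topspace X. patch X A\<^sub>0 A\<^sub>1 h x = 0} = A\<^sub>0 \<union> {x \<in> ?R. h x = 0}"
    using sub by (auto simp: patch_def)
  then show "openin X {x \<in> topspace X. patch X A\<^sub>0 A\<^sub>1 h x = 0}"
    using iso' assms(1) by (metis openin_Un)
  have "{x \<in> topspace X. patch X A\<^sub>0 A\<^sub>1 h x = 1} = A\<^sub>1 \<union> {x \<in> ?R. h x = 1}"
    using sub \<open>disjnt A\<^sub>0 A\<^sub>1\<close> by (auto simp: patch_def disjnt_iff split: if_splits)
  then show "openin X {x \<in> topspace X. patch X A\<^sub>0 A\<^sub>1 h x = 1}"
    using iso' assms(2) by (metis openin_Un)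
qed (use h in \<open>auto simp: patch_def\<close>)

text \<open>The set is the image under \<open>patch\<close> of the power of \<open>{0, 1}\<close>
  over the isolated points \<open>R\<close> left free, which is compact by Tychonoff; what has to be
  shown is that \<open>patch\<close> is continuous into the compact-open topology.\<close>

lemma compactin_Ck_two_prescribed:
  assumes op: "openin X A\<^sub>0" "openin X A\<^sub>1" "disjnt A\<^sub>0 A\<^sub>1"
    and iso: "\<And>x. x \<in> topspace X - A\<^sub>0 - A\<^sub>1 \<Longrightarrow> openin X {x}"
  shows "compactin (Ck X two) {f \<in> cfuns X two. (\<forall>x\<in>A\<^sub>0. f x = 0) \<and> (\<forall>x\<in>A\<^sub>1. f x = 1)}"
proof -
  define R where "R = topspace X - A\<^sub>0 - A\<^sub>1"
  define P where "P = product_topology (\<lambda>_. discrete_topology {0, 1 :: nat}) R"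
  have sub: "A\<^sub>0 \<subseteq> topspace X" "A\<^sub>1 \<subseteq> topspace X"
    using op by (auto dest: openin_subset)
  have topP: "topspace P = R \<rightarrow>\<^sub>E {0, 1}"
    by (simp add: P_def)
  have patch: "patch X A\<^sub>0 A\<^sub>1 h \<in> cfuns X two" if "h \<in> R \<rightarrow>\<^sub>E {0, 1}" for h
    by (rule patch_in_cfuns) (use assms PiE_mem[OF that] in \<open>auto simp: R_def\<close>)
  have "openin P {h \<in> topspace P. patch X A\<^sub>0 A\<^sub>1 h \<in> W}" if W: "openin (Ck X two) W" for W
    unfolding P_def openin_product_discrete_topology
  proof (intro conjI ballI)
    fix h assume "h \<in> {h \<in> topspace (product_topology (\<lambda>_. discrete_topology {0, 1}) R). patch X A\<^sub>0 A\<^sub>1 h \<in> W}"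
    then have h: "patch X A\<^sub>0 A\<^sub>1 h \<in> W" by simp
    then obtain K where K: "compactin X K"
      "\<forall>g\<in>cfuns X two. (\<forall>x\<in>K. g x = patch X A\<^sub>0 A\<^sub>1 h x) \<longrightarrow> g \<in> W"
      using W unfolding openin_Ck_two_iff by blast
    \<comment> \<open>Compactness leaves only finitely many points of \<open>K\<close> in
      \<open>R\<close>, so finitely many coordinates of \<open>h\<close> determine the patched map
      on \<open>K\<close>.\<close>
    have "K \<subseteq> \<Union>{A\<^sub>0, A\<^sub>1} \<union> R"
      using compactin_subset_topspace[OF K(1)] by (auto simp: R_def)
    then have "\<exists>\<T> F. finite \<T> \<and> \<T> \<subseteq> {A\<^sub>0, A\<^sub>1} \<and> finite F \<and> F \<subseteq> R \<and> K \<subseteq> \<Union>\<T> \<union> F"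
      by (intro compactin_cover_isolated[OF K(1)]) (use op iso in \<open>auto simp: R_def\<close>)
    then obtain \<T> F where F: "\<T> \<subseteq> {A\<^sub>0, A\<^sub>1}" "finite F" "F \<subseteq> R" "K \<subseteq> \<Union>\<T> \<union> F"
      by blast
    have "patch X A\<^sub>0 A\<^sub>1 g \<in> W" if g: "g \<in> R \<rightarrow>\<^sub>E {0, 1}" "\<forall>i\<in>F. g i = h i" for g
    proof -
      have "patch X A\<^sub>0 A\<^sub>1 g x = patch X A\<^sub>0 A\<^sub>1 h x" if "x \<in> K" for x
        using that F g(2) by (auto simp: patch_def)
      then show ?thesis
        using K(2) patch[OF g(1)] by blast
    qed
    then show "\<exists>F. finite F \<and> F \<subseteq> R \<and> (\<forall>g\<in>R \<rightarrow>\<^sub>E {0, 1}. (\<forall>i\<in>F. g i = h i) \<longrightarrow>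
        g \<in> {h \<in> topspace (product_topology (\<lambda>_. discrete_topology {0, 1}) R). patch X A\<^sub>0 A\<^sub>1 h \<in> W})"
      using F by (intro exI[of _ F]) simp
  qed simp
  then have cont: "continuous_map P (Ck X two) (patch X A\<^sub>0 A\<^sub>1)"
    using patch by (simp add: continuous_map_def topP Pi_iff)
  have "compact_space P"
    unfolding P_def by (simp add: compact_space_product_topology compact_space_discrete_topology)
  then have "compactin (Ck X two) (patch X A\<^sub>0 A\<^sub>1 ` topspace P)"
    using cont image_compactin unfolding compact_space_def by blast
  moreover have "patch X A\<^sub>0 A\<^sub>1 ` topspace P =
      {f \<in> cfuns X two. (\<forall>x\<in>A\<^sub>0. f x = 0) \<and> (\<forall>x\<in>A\<^sub>1. f x = 1)}"
  proof (intro equalityI subsetI)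
    fix f assume "f \<in> patch X A\<^sub>0 A\<^sub>1 ` topspace P"
    then obtain h where "h \<in> R \<rightarrow>\<^sub>E {0, 1}" "f = patch X A\<^sub>0 A\<^sub>1 h"
      using topP by blast
    then show "f \<in> {f \<in> cfuns X two. (\<forall>x\<in>A\<^sub>0. f x = 0) \<and> (\<forall>x\<in>A\<^sub>1. f x = 1)}"
      using patch sub \<open>disjnt A\<^sub>0 A\<^sub>1\<close> by (auto simp: patch_def disjnt_iff)
  next
    fix f assume f: "f \<in> {f \<in> cfuns X two. (\<forall>x\<in>A\<^sub>0. f x = 0) \<and> (\<forall>x\<in>A\<^sub>1. f x = 1)}"
    have "f = patch X A\<^sub>0 A\<^sub>1 (restrict f R)"
    proof
      fix x show "f x = patch X A\<^sub>0 A\<^sub>1 (restrict f R) x"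
        using f by (auto simp: patch_def R_def cfuns_def extensional_def)
    qed
    moreover have "restrict f R \<in> topspace P"
      using f cfuns_two_range[of f X] unfolding topP R_def by (auto simp: restrict_PiE_iff)
    ultimately show "f \<in> patch X A\<^sub>0 A\<^sub>1 ` topspace P"
      by blast
  qed
  ultimately show ?thesis by simp
qed

text \<open>\<open>\<B>\<close> is a countable outer base of the derived set. A tube argument around
  compact sets of maps with prescribed values reduces a given cover to countably many finite
  subfamilies.\<close>

lemma Lindelof_space_Ck_two:
  assumes "countable \<B>" and op\<B>: "\<And>B. B \<in> \<B> \<Longrightarrow> openin X B"
    and base: "\<And>x U. \<lbrakk>x \<in> X derived_set_of (topspace X); openin X U; x \<in> U\<rbrakk> \<Longrightarrow> \<exists>B\<in>\<B>. x \<in> B \<and> B \<subseteq> U"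
  shows "Lindelof_space (Ck X two)"
  unfolding Lindelof_space_def
proof (intro allI impI)
  fix \<U> assume \<U>: "(\<forall>U\<in>\<U>. openin (Ck X two) U) \<and> \<Union>\<U> = topspace (Ck X two)"
  \<comment> \<open>\<open>N\<close> collects the maps that obey a finite family of prescriptions
    taken from \<open>\<B>\<close>, and \<open>I\<close> the families for which \<open>N\<close> is
    covered by finitely many members of \<open>\<U>\<close>. As \<open>I\<close> is countable, it
    suffices that every map lies in \<open>N \<T>\<close> for some \<open>\<T>\<close> in
    \<open>I\<close>.\<close>
  define N where "N = (\<lambda>(\<S>\<^sub>0, \<S>\<^sub>1). {g \<in> cfuns X two. (\<forall>x\<in>\<Union>\<S>\<^sub>0. g x = 0) \<and> (\<forall>x\<in>\<Union>\<S>\<^sub>1. g x = 1)})"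
  define I where "I = {\<T> \<in> {\<T>. finite \<T> \<and> \<T> \<subseteq> \<B>} \<times> {\<T>. finite \<T> \<and> \<T> \<subseteq> \<B>}.
      \<exists>\<F>. finite \<F> \<and> \<F> \<subseteq> \<U> \<and> N \<T> \<subseteq> \<Union>\<F>}"
  have "\<exists>\<T>\<in>I. f \<in> N \<T>" if f: "f \<in> cfuns X two" for f
  proof -
    \<comment> \<open>All base members on which \<open>f\<close> is constantly \<open>i\<close>.
      Together they cover the derived set, since each fibre of \<open>f\<close> is open, so
      \<open>R\<close> has only isolated points.\<close>
    define \<S> where "\<S> i = {B \<in> \<B>. B \<subseteq> {x \<in> topspace X. f x = i}}" for i
    define R where "R = topspace X - \<Union>(\<S> 0) - \<Union>(\<S> 1)"
    have op: "openin X (\<Union>(\<S> i))" for i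
      using op\<B> by (auto simp: \<S>_def)
    have dis: "disjnt (\<Union>(\<S> 0)) (\<Union>(\<S> 1))"
      unfolding \<S>_def disjnt_iff by force
    have iso: "openin X {x}" if "x \<in> R" for x
    proof (rule ccontr)
      assume "\<not> openin X {x}"
      then have x: "x \<in> X derived_set_of (topspace X)"
        using that by (simp add: derived_set_of_topspace R_def)
      have "x \<in> topspace X" "f x = 0 \<or> f x = 1"
        using that cfuns_two_range[OF f] by (auto simp: R_def)
      then have "x \<in> \<Union>(\<S> (f x))"
        using base[OF x openin_cfuns_two_fibre[OF f, of "f x"]] by (auto simp: \<S>_def)
      then show False
        using that \<open>f x = 0 \<or> f x = 1\<close> by (auto simp: R_def)
    qed
    \<comment> \<open>\<open>C\<close> obeys all prescriptions at once, possibly infinitely many; it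
      is compact, and the task is to pass from it to finitely many of them.\<close>
    define C where "C = {g \<in> cfuns X two. (\<forall>x\<in>\<Union>(\<S> 0). g x = 0) \<and> (\<forall>x\<in>\<Union>(\<S> 1). g x = 1)}"
    have "compactin (Ck X two) C"
      unfolding C_def by (rule compactin_Ck_two_prescribed[OF op op dis]) (use iso in \<open>simp add: R_def\<close>)
    have "\<exists>K U. compactin X K \<and> U \<in> \<U> \<and> {h \<in> cfuns X two. \<forall>x\<in>K. h x = g x} \<subseteq> U" if "g \<in> C" for g
    proof -
      have "g \<in> \<Union>\<U>"
        using that \<U> by (simp add: C_def)
      then obtain U where "U \<in> \<U>" "g \<in> U"
        by blast
      then obtain K where "compactin X K" "\<forall>h\<in>cfuns X two. (\<forall>x\<in>K. h x = g x) \<longrightarrow> h \<in> U"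
        using \<U> openin_Ck_two_iff[of X U] by blast
      then show ?thesis
        using \<open>U \<in> \<U>\<close> by (intro exI[of _ K] exI[of _ U]) blast
    qed
    then have "\<forall>g\<in>C. \<exists>K U. compactin X (K) \<and> U \<in> \<U> \<and> {h \<in> cfuns X two. \<forall>x\<in>K. h x = g x} \<subseteq> U"
      by blast
    from bchoice[OF this] obtain K where
      "\<forall>g\<in>C. \<exists>U. compactin X (K g) \<and> U \<in> \<U> \<and> {h \<in> cfuns X two. \<forall>x\<in>K g. h x = g x} \<subseteq> U"
      by (elim exE)
    from bchoice[OF this] obtain U where
      KU: "\<forall>g\<in>C. compactin X (K g) \<and> U g \<in> \<U> \<and> {h \<in> cfuns X two. \<forall>x\<in>K g. h x = g x} \<subseteq> U g"
      by (elim exE)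
    \<comment> \<open>Neighbourhoods given by agreement on \<open>K g\<close>, each inside one
      member of the cover; finitely many of them cover \<open>C\<close>.\<close>
    define Q where "Q g = {h \<in> cfuns X two. \<forall>x\<in>K g. h x = g x}" for g
    have "\<exists>\<F>. finite \<F> \<and> \<F> \<subseteq> Q ` C \<and> C \<subseteq> \<Union>\<F>"
    proof (rule compactinD[OF \<open>compactin (Ck X two) C\<close>])
      show "openin (Ck X two) V" if "V \<in> Q ` C" for V
        using that KU openin_Ck_two_agree unfolding Q_def by blast
      show "C \<subseteq> \<Union>(Q ` C)"
        by (auto simp: C_def Q_def)
    qed
    then obtain G where G: "finite G" "G \<subseteq> C" and CG: "C \<subseteq> \<Union>(Q ` G)"
      by (metis finite_subset_image)
    have "compactin X (\<Union>(K ` G))"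
      using G KU by (intro compactin_Union) auto
    \<comment> \<open>Only the compact union of the sets \<open>K g\<close> with \<open>g\<close> in
      \<open>G\<close> matters, and finitely many prescriptions \<open>\<T>\<close> cover it up to
      finitely many points of \<open>R\<close>.\<close>
    moreover have "\<Union>(K ` G) \<subseteq> \<Union>(\<S> 0 \<union> \<S> 1) \<union> R"
      using compactin_subset_topspace[OF calculation] by (auto simp: R_def)
    ultimately have "\<exists>\<T> F. finite \<T> \<and> \<T> \<subseteq> \<S> 0 \<union> \<S> 1 \<and> finite F \<and> F \<subseteq> R \<and> \<Union>(K ` G) \<subseteq> \<Union>\<T> \<union> F"
      by (intro compactin_cover_isolated) (use iso op\<B> in \<open>auto simp: \<S>_def\<close>)
    then obtain \<T> F where T: "finite \<T>" "\<T> \<subseteq> \<S> 0 \<union> \<S> 1" "F \<subseteq> R" "\<Union>(K ` G) \<subseteq> \<Union>\<T> \<union> F"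
      by blast
    have "h \<in> \<Union>(U ` G)" if h: "h \<in> N (\<T> \<inter> \<S> 0, \<T> \<inter> \<S> 1)" for h
    proof -
      have hc: "h \<in> cfuns X two"
        using h by (simp add: N_def)
      \<comment> \<open>Forcing every prescription on \<open>h\<close> yields a member
        \<open>g\<close> of \<open>C\<close>. On the compact union nothing changes: at points of
        \<open>R\<close> the patch keeps \<open>h\<close>, and on members of \<open>\<T>\<close> the
        map \<open>h\<close> already has the prescribed value. So \<open>h\<close> lies in the same
        member of the cover as \<open>g\<close>.\<close>
      define g where "g = patch X (\<Union>(\<S> 0)) (\<Union>(\<S> 1)) h"
      have sub: "\<Union>(\<S> i) \<subseteq> topspace X" for i
        using op openin_subset by blast
      have "g \<in> cfuns X two"
        unfolding g_def
        by (rule patch_in_cfuns[OF op op dis]) (use iso cfuns_two_range[OF hc] in \<open>auto simp: R_def\<close>)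
      moreover have g0: "g x = 0" if "x \<in> \<Union>(\<S> 0)" for x
        using that sub[of 0] by (simp add: g_def patch_def subset_iff)
      moreover have g1: "g x = 1" if "x \<in> \<Union>(\<S> 1)" for x
        using that sub[of 1] dis unfolding g_def patch_def disjnt_iff by auto
      ultimately have "g \<in> C"
        unfolding C_def by blast
      then obtain g' where g': "g' \<in> G" "\<forall>x\<in>K g'. g x = g' x"
        using CG unfolding Q_def by blast
      have "h x = g x" if "x \<in> \<Union>(K ` G)" for x
      proof -
        have "x \<in> \<Union>\<T> \<union> F"
          using T(4) that by (rule subsetD)
        then consider "x \<in> R" | B where "B \<in> \<T>" "x \<in> B" "B \<in> \<S> 0 \<or> B \<in> \<S> 1"
          using T(2,3) by auto
        then show ?thesis
        proof cases
          case 1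
          then show ?thesis by (simp add: g_def patch_def R_def)
        next
          case 2
          then have "B \<in> \<S> 0 \<Longrightarrow> h x = 0" "B \<in> \<S> 1 \<Longrightarrow> h x = 1"
            using h by (auto simp: N_def)
          then show ?thesis
            using 2(3) g0[OF UnionI[OF _ 2(2)]] g1[OF UnionI[OF _ 2(2)]] by auto
        qed
      qed
      then have "\<forall>x\<in>K g'. h x = g' x"
        using g' by (metis UN_I)
      then show ?thesis
        using KU g'(1) G(2) hc by blast
    qed
    then have "N (\<T> \<inter> \<S> 0, \<T> \<inter> \<S> 1) \<subseteq> \<Union>(U ` G)" by blast
    moreover have "finite (U ` G)" "U ` G \<subseteq> \<U>"
      using G KU by auto
    ultimately have "(\<T> \<inter> \<S> 0, \<T> \<inter> \<S> 1) \<in> I"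
      unfolding I_def using T(1) by (auto simp: \<S>_def)
    moreover have "f \<in> N (\<T> \<inter> \<S> 0, \<T> \<inter> \<S> 1)"
      using f by (auto simp: N_def \<S>_def)
    ultimately show ?thesis by blast
  qed
  moreover have "\<forall>\<T>\<in>I. \<exists>\<F>. finite \<F> \<and> \<F> \<subseteq> \<U> \<and> N \<T> \<subseteq> \<Union>\<F>"
    by (simp add: I_def)
  from bchoice[OF this] obtain \<F> where \<F>: "\<forall>\<T>\<in>I. finite (\<F> \<T>) \<and> \<F> \<T> \<subseteq> \<U> \<and> N \<T> \<subseteq> \<Union>(\<F> \<T>)"
    by (elim exE)
  ultimately have "cfuns X two \<subseteq> \<Union>(\<Union>(\<F> ` I))"
    by blast
  moreover have "\<Union>(\<F> ` I) \<subseteq> \<U>"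
    using \<F> by blast
  moreover from this have "\<Union>(\<Union>(\<F> ` I)) \<subseteq> cfuns X two"
    using \<U> Union_mono by fastforce
  moreover have "countable I"
    unfolding I_def using \<open>countable \<B>\<close>
    by (intro countable_Collect countable_SIGMA countable_Collect_finite_subset)
  then have "countable (\<Union>(\<F> ` I))"
    using \<F> countable_finite by blast
  ultimately show "\<exists>\<V>. countable \<V> \<and> \<V> \<subseteq> \<U> \<and> \<Union>\<V> = topspace (Ck X two)"
    by (intro exI[of _ "\<Union>(\<F> ` I)"] conjI equalityI) simp_all
qed

subsection \<open>Uncountable powers of the discrete space of natural numbers\<close>

text \<open>Two disjoint closed sets cannot be separated: a sequence of finitely supported points of
  \<open>P 0\<close> is built so that its limit, completed by the value 1, lies in
  \<open>P 1\<close> and forces any neighbourhoods of the two sets to meet.\<close>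

theorem not_normal_space_uncountable_power_nat:
  assumes "uncountable E"
  shows "\<not> normal_space (product_topology (\<lambda>_. discrete_topology (UNIV :: nat set)) E)"
proof
  let ?Y = "product_topology (\<lambda>_. discrete_topology (UNIV :: nat set)) E"
  let ?S = "E \<rightarrow>\<^sub>E (UNIV :: nat set)"
  assume normal: "normal_space ?Y"
  \<comment> \<open>The functions that are injective outside their fibre over \<open>k\<close>.
    Failure is witnessed by two coordinates, whence \<open>P k\<close> is closed.\<close>
  define P where "P k = {f \<in> ?S. \<forall>i\<in>E. \<forall>j\<in>E. f i = f j \<longrightarrow> f i \<noteq> k \<longrightarrow> i = j}" for k
  have P_D: "i = j" if "f \<in> P k" "i \<in> E" "j \<in> E" "f i = f j" "f i \<noteq> k" for f k i j
    using that unfolding P_def by simp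
  have "openin ?Y (?S - P k)" for k
    unfolding openin_product_discrete_topology
  proof (intro conjI ballI)
    fix f assume "f \<in> ?S - P k"
    then obtain i j where ij: "i \<in> E" "j \<in> E" "f i = f j" "f i \<noteq> k" "i \<noteq> j"
      by (auto simp: P_def)
    have "g \<in> ?S - P k" if "g \<in> ?S" "\<forall>l\<in>{i, j}. g l = f l" for g
    proof -
      have "g i = g j" "g i \<noteq> k"
        using that(2) ij by (metis insertI1 insertI2)+
      then have "g \<notin> P k"
        using ij P_D by metis
      then show ?thesis
        using that(1) by blast
    qed
    with ij show "\<exists>F. finite F \<and> F \<subseteq> E \<and> (\<forall>g\<in>?S. (\<forall>l\<in>F. g l = f l) \<longrightarrow> g \<in> ?S - P k)"
      by (intro exI[of _ "{i, j}"]) simp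
  qed blast
  then have closed: "closedin ?Y (P k)" for k
    unfolding closedin_def by (auto simp: P_def)
  have disjoint: "disjnt (P 0) (P 1)"
  proof -
    \<comment> \<open>A repeated value would have to be both 0 and 1; so a common member would embed
      \<open>E\<close> into the natural numbers.\<close>
    have "inj_on f E" if "f \<in> P 0" "f \<in> P 1" for f
    proof (rule inj_onI)
      fix i j assume "i \<in> E" "j \<in> E" "f i = f j"
      then show "i = j"
        using that P_D[of f 0 i j] P_D[of f 1 i j] by linarith
    qed
    then show ?thesis
      using \<open>uncountable E\<close> countableI unfolding disjnt_iff by blast
  qed
  have "\<exists>U V. openin ?Y U \<and> openin ?Y V \<and> P 0 \<subseteq> U \<and> P 1 \<subseteq> V \<and> disjnt U V"
    using normal[unfolded normal_space_def, rule_format, of "P 0" "P 1"] closed disjoint by simp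
  then obtain U V where UV: "openin ?Y U" "openin ?Y V" "P 0 \<subseteq> U" "P 1 \<subseteq> V" "disjnt U V"
    by (elim exE conjE)
  have "\<forall>f\<in>U. \<exists>F. finite F \<and> F \<subseteq> E \<and> (\<forall>g\<in>?S. (\<forall>i\<in>F. g i = f i) \<longrightarrow> g \<in> U)"
    using UV(1) unfolding openin_product_discrete_topology by (rule conjunct2)
  from bchoice[OF this] obtain F where
    F: "\<forall>f\<in>U. finite (F f) \<and> F f \<subseteq> E \<and> (\<forall>g\<in>?S. (\<forall>i\<in>F f. g i = f i) \<longrightarrow> g \<in> U)"
    by (elim exE)
  \<comment> \<open>\<open>F x\<close> is a finite set of coordinates that secures membership of
    \<open>x\<close> in \<open>U\<close>. A successor in the sequence keeps all nonzero values of
    \<open>x\<close> and is nonzero on the whole of \<open>F x\<close>.\<close>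
  define good where "good x \<longleftrightarrow> x \<in> P 0 \<and> finite {i \<in> E. x i \<noteq> 0}" for x
  define extends where "extends x y \<longleftrightarrow> (\<forall>i\<in>E. x i \<noteq> 0 \<longrightarrow> y i = x i) \<and> (\<forall>i\<in>F x. y i \<noteq> 0)" for x y
  have step: "\<exists>y. good y \<and> extends x y" if "good x" for x
  proof -
    define S where "S = {i \<in> E. x i \<noteq> 0}"
    define T where "T = F x - S"
    have x: "x \<in> P 0" "finite S"
      using that by (auto simp: good_def S_def)
    then have T: "finite T" "T \<subseteq> E"
      using F UV(3) by (auto simp: T_def)
    obtain e :: "_ \<Rightarrow> nat" where e: "inj_on e T"
      using \<open>finite T\<close> finite_imp_inj_to_nat_seg by metis
    obtain N where N: "\<And>i. i \<in> S \<Longrightarrow> x i \<le> N"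
      using \<open>finite S\<close> by (metis Max_ge finite_imageI imageI)
    \<comment> \<open>The new values are nonzero, pairwise distinct and larger than the bound
      \<open>N\<close> for the old ones, so \<open>y\<close> stays in \<open>P 0\<close>.\<close>
    define y where "y = (\<lambda>i\<in>E. if i \<in> T then Suc (N + e i) else x i)"
    have "y \<in> P 0"
    proof -
      have "i = j" if ij: "i \<in> E" "j \<in> E" "y i = y j" "y i \<noteq> 0" for i j
      proof -
        have "i \<in> S \<or> i \<in> T" "j \<in> S \<or> j \<in> T"
          using ij by (auto simp: y_def S_def split: if_splits)
        then show ?thesis
          using ij N[of i] N[of j] x(1) inj_onD[OF e, of i j]
          by (auto simp: y_def P_def T_def split: if_splits)
      qed
      then show ?thesis
        unfolding P_def y_def by simp
    qed
    moreover have "finite {i \<in> E. y i \<noteq> 0}"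
      by (rule finite_subset[of _ "S \<union> T"]) (use x T in \<open>auto simp: y_def S_def\<close>)
    moreover have "extends x y"
      using F UV(3) x(1) unfolding extends_def y_def by (auto simp: S_def T_def)
    ultimately show ?thesis
      unfolding good_def by blast
  qed
  have "good (\<lambda>i\<in>E. 0)"
    by (simp add: good_def P_def cong: conj_cong)
  then have "\<exists>X. \<forall>n :: nat. good (X n) \<and> extends (X n) (X (Suc n))"
    using step by (intro dependent_nat_choice[of "\<lambda>_. good" "\<lambda>_. extends"]) auto
  then obtain X where X: "\<And>n. good (X n)" "\<And>n :: nat. extends (X n) (X (Suc n))"
    by blast
  have stable: "X n i = X m i" if "i \<in> E" "X m i \<noteq> 0" "m \<le> n" for m n i
    using that(3) by (induction rule: dec_induct) (use that X(2) in \<open>auto simp: extends_def\<close>)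
  define B where "B = {i \<in> E. \<exists>n. X n i \<noteq> 0}"
  \<comment> \<open>On \<open>B\<close> this is the eventually constant nonzero value of the
    sequence, and off \<open>B\<close> the default is 1. Two points of \<open>B\<close> are already
    nonzero at a common stage, where \<open>X n\<close> separates them, so 1 is the only value that
    can repeat.\<close>
  define y where "y = (\<lambda>i\<in>E. if i \<in> B then X (LEAST n. X n i \<noteq> 0) i else 1)"
  have y: "y i = X n i" if "i \<in> E" "X n i \<noteq> 0" for i n
    using that stable[OF that(1) LeastI[of "\<lambda>n. X n i \<noteq> 0" n] Least_le[of "\<lambda>n. X n i \<noteq> 0" n]]
    by (auto simp: y_def B_def)
  have late: "\<exists>n. \<forall>i\<in>C. X n i \<noteq> 0" if "finite C" "C \<subseteq> B" for C
    using that
  proof (induction C)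
    case (insert i C)
    then obtain n where "\<forall>i\<in>C. X n i \<noteq> 0"
      by auto
    moreover obtain m where "X m i \<noteq> 0"
      using insert.prems by (auto simp: B_def)
    moreover have "insert i C \<subseteq> E"
      using insert.prems by (auto simp: B_def)
    ultimately have "\<forall>j\<in>insert i C. X (max m n) j \<noteq> 0"
      by (metis insert_iff max.cobounded1 max.cobounded2 stable subsetD)
    then show ?case by blast
  qed auto
  have "y \<in> P 1"
  proof -
    have "i = j" if ij: "i \<in> E" "j \<in> E" "y i = y j" "y i \<noteq> 1" for i j
    proof -
      have "i \<in> B" "j \<in> B"
        using ij by (auto simp: y_def split: if_splits)
      then obtain n where "X n i \<noteq> 0" "X n j \<noteq> 0"
        using late[of "{i, j}"] by auto
      then show ?thesis
        using ij X(1)[of n] y[of i n] y[of j n] by (auto simp: good_def P_def)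
    qed
    then show ?thesis
      unfolding P_def y_def by simp
  qed
  then have "y \<in> V"
    using UV(4) by blast
  then obtain C where C: "finite C" "C \<subseteq> E" "\<forall>g\<in>?S. (\<forall>i\<in>C. g i = y i) \<longrightarrow> g \<in> V"
    using UV(2) unfolding openin_product_discrete_topology by blast
  \<comment> \<open>By stage \<open>n\<close> the sequence has reached its limit values on the part
    of \<open>C\<close> inside \<open>B\<close>, where \<open>C\<close> secures membership in
    \<open>V\<close>.\<close>
  obtain n where n: "\<forall>i\<in>C \<inter> B. X n i \<noteq> 0"
    using late[of "C \<inter> B"] C(1) by blast
  have XU: "X n \<in> U"
    using X(1)[of n] UV(3) by (auto simp: good_def)
  \<comment> \<open>A common point of \<open>U\<close> and \<open>V\<close>: it follows
    \<open>X n\<close> on \<open>F (X n)\<close>, which gives \<open>U\<close>, and \<open>y\<close>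
    elsewhere.\<close>
  define z where "z = (\<lambda>i\<in>E. if i \<in> F (X n) then X n i else y i)"
  have "z \<in> ?S"
    by (simp add: z_def)
  have "z \<in> U"
  proof -
    have "\<forall>i\<in>F (X n). z i = X n i"
      using bspec[OF F XU] by (auto simp: z_def)
    then show ?thesis
      using bspec[OF F XU] \<open>z \<in> ?S\<close> by blast
  qed
  \<comment> \<open>On \<open>F (X n)\<close> stage \<open>n + 1\<close> is nonzero, so such a
    coordinate of \<open>C\<close> lies in \<open>B\<close>; by the choice of \<open>n\<close> it is
    nonzero already at stage \<open>n\<close>, where \<open>X n\<close> and \<open>y\<close>
    agree.\<close>
  moreover have "z i = y i" if "i \<in> C" for i
  proof (cases "i \<in> F (X n)")
    case True
    then have "X (Suc n) i \<noteq> 0"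
      using X(2)[of n] by (simp add: extends_def)
    then have "X n i \<noteq> 0"
      using n C(2) that unfolding B_def by blast
    then show ?thesis
      using y[of i n] C(2) that by (auto simp: z_def)
  next
    case False
    then show ?thesis
      using C(2) that by (auto simp: z_def)
  qed
  then have "z \<in> V"
    using C(3) \<open>z \<in> ?S\<close> by blast
  ultimately show False
    using UV(5) by (auto simp: disjnt_iff)
qed

subsection \<open>Powers of the natural numbers as retracts\<close>

lemma openin_Union_clopen_locally_finite:
  assumes "\<And>a. a \<in> E \<Longrightarrow> openin X (D a) \<and> closedin X (D a)"
    and "\<And>x. x \<in> topspace X \<Longrightarrow> \<exists>W. openin X W \<and> x \<in> W \<and> finite {a \<in> E. D a \<inter> W \<noteq> {}}"
  shows "openin X (\<Union>(D ` E))" "closedin X (\<Union>(D ` E))"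
proof -
  show "openin X (\<Union>(D ` E))"
    using assms(1) by blast
  have "locally_finite_in X (D ` E)"
    unfolding locally_finite_in_def
  proof (intro conjI ballI)
    show "\<Union>(D ` E) \<subseteq> topspace X"
      using assms(1) openin_subset by blast
    fix x assume "x \<in> topspace X"
    then obtain W where W: "openin X W" "x \<in> W" "finite {a \<in> E. D a \<inter> W \<noteq> {}}"
      using assms(2) by blast
    have "{U \<in> D ` E. U \<inter> W \<noteq> {}} \<subseteq> D ` {a \<in> E. D a \<inter> W \<noteq> {}}"
      by auto
    then have "finite {U \<in> D ` E. U \<inter> W \<noteq> {}}"
      using W(3) finite_surj by blast
    then show "\<exists>V. openin X V \<and> x \<in> V \<and> finite {U \<in> D ` E. U \<inter> V \<noteq> {}}"
      using W by blast
  qed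
  then show "closedin X (\<Union>(D ` E))"
    using assms(1) by (intro closedin_locally_finite_Union) auto
qed

text \<open>A cover by open sets that meet few \<open>D a\<close> has a finite subcover. This bounds
  the exponents that can influence an indicator on a compact set.\<close>

lemma compactin_meets_finite:
  assumes K: "compactin X K"
    and "\<And>x. x \<in> topspace X \<Longrightarrow> \<exists>W. openin X W \<and> x \<in> W \<and> finite {a \<in> E. D a \<inter> W \<noteq> {}}"
  shows "finite {a \<in> E. D a \<inter> K \<noteq> {}}"
proof -
  have "\<exists>\<F>. finite \<F> \<and> \<F> \<subseteq> {W. openin X W \<and> finite {a \<in> E. D a \<inter> W \<noteq> {}}} \<and> K \<subseteq> \<Union>\<F>"
    by (rule compactinD[OF K]) (use assms(2) compactin_subset_topspace[OF K] in blast)+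
  then obtain \<F> where \<F>: "finite \<F>" "\<F> \<subseteq> {W. openin X W \<and> finite {a \<in> E. D a \<inter> W \<noteq> {}}}" "K \<subseteq> \<Union>\<F>"
    by (elim exE conjE)
  have "{a \<in> E. D a \<inter> K \<noteq> {}} \<subseteq> (\<Union>W\<in>\<F>. {a \<in> E. D a \<inter> W \<noteq> {}})"
  proof
    fix a assume "a \<in> {a \<in> E. D a \<inter> K \<noteq> {}}"
    then obtain x where "a \<in> E" "x \<in> D a" "x \<in> K"
      by auto
    moreover from this obtain W where "W \<in> \<F>" "x \<in> W"
      using \<F>(3) by auto
    ultimately show "a \<in> (\<Union>W\<in>\<F>. {a \<in> E. D a \<inter> W \<noteq> {}})"
      by auto
  qed
  moreover have "finite (\<Union>W\<in>\<F>. {a \<in> E. D a \<inter> W \<noteq> {}})"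
    using \<F>(1,2) by blast
  ultimately show ?thesis
    by (rule finite_subset)
qed

text \<open>The section sends \<open>\<nu>\<close> to the indicator of the union of the sets \<open>V a 0 - V a (\<nu> a)\<close>.
  The exponent is recovered from such an indicator \<open>f\<close> as the first \<open>n\<close> at which \<open>f\<close> agrees
  with its value at the limit \<open>a\<close> of the points \<open>p a n\<close>.\<close>

lemma power_nat_retract_of_cfuns_two:
  fixes V :: "'a \<Rightarrow> nat \<Rightarrow> 'a set" and p :: "'a \<Rightarrow> nat \<Rightarrow> 'a"
  assumes clopen: "\<And>a n. a \<in> E \<Longrightarrow> openin X (V a n) \<and> closedin X (V a n)"
    and dec: "\<And>a m n. \<lbrakk>a \<in> E; m \<le> n\<rbrakk> \<Longrightarrow> V a n \<subseteq> V a m"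
    and aV: "\<And>a n. a \<in> E \<Longrightarrow> a \<in> V a n"
    and p: "\<And>a n. a \<in> E \<Longrightarrow> p a n \<in> V a n - V a (Suc n)"
    and lim: "\<And>a W. \<lbrakk>a \<in> E; openin X W; a \<in> W\<rbrakk> \<Longrightarrow> \<exists>n. p a n \<in> W"
    and disj: "\<And>a b. \<lbrakk>a \<in> E; b \<in> E; a \<noteq> b\<rbrakk> \<Longrightarrow> disjnt (V a 0) (V b 0)"
    and lf: "\<And>x. x \<in> topspace X \<Longrightarrow> \<exists>W. openin X W \<and> x \<in> W \<and> finite {a \<in> E. V a 0 \<inter> W \<noteq> {}}"
  obtains r e where
    "continuous_map (Cp X two) (product_topology (\<lambda>_. discrete_topology (UNIV :: nat set)) E) r"
    "continuous_map (product_topology (\<lambda>_. discrete_topology (UNIV :: nat set)) E) (Ck X two) e"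
    "\<forall>\<nu> \<in> topspace (product_topology (\<lambda>_. discrete_topology (UNIV :: nat set)) E). r (e \<nu>) = \<nu>"
proof
  let ?Y = "product_topology (\<lambda>_. discrete_topology (UNIV :: nat set)) E"
  define A where "A \<nu> = (\<Union>a\<in>E. V a 0 - V a (\<nu> a))" for \<nu>
  define e where "e \<nu> = (\<lambda>x\<in>topspace X. if x \<in> A \<nu> then 1 else 0 :: nat)" for \<nu>
  define r where "r f = (\<lambda>a\<in>E. LEAST n. f (p a n) = f a)" for f :: "'a \<Rightarrow> nat"
  have topV: "V a n \<subseteq> topspace X" if "a \<in> E" for a n
    using clopen[OF that] openin_subset by blast
  have clopenA: "openin X (A \<nu>) \<and> closedin X (A \<nu>)" for \<nu>
  proof -
    have D: "openin X (V a 0 - V a (\<nu> a)) \<and> closedin X (V a 0 - V a (\<nu> a))" if "a \<in> E" for a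
      using clopen[OF that] by (simp add: openin_diff closedin_diff)
    have "\<exists>W. openin X W \<and> x \<in> W \<and> finite {a \<in> E. (V a 0 - V a (\<nu> a)) \<inter> W \<noteq> {}}"
      if "x \<in> topspace X" for x
    proof -
      from lf[OF that] obtain W where W: "openin X W" "x \<in> W" "finite {a \<in> E. V a 0 \<inter> W \<noteq> {}}"
        by (elim exE conjE)
      have "finite {a \<in> E. (V a 0 - V a (\<nu> a)) \<inter> W \<noteq> {}}"
        by (rule finite_subset[OF _ W(3)]) blast
      with W show ?thesis
        by (intro exI[of _ W] conjI)
    qed
    note openin_Union_clopen_locally_finite[OF D this]
    then show ?thesis
      unfolding A_def by (rule conjI)
  qed
  have e_cfuns: "e \<nu> \<in> cfuns X two" for \<nu>
  proof (rule cfuns_twoI)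
    have "{x \<in> topspace X. e \<nu> x = 0} = topspace X - A \<nu>"
      by (auto simp: e_def)
    then show "openin X {x \<in> topspace X. e \<nu> x = 0}"
      using clopenA by (simp add: openin_diff)
    have "{x \<in> topspace X. e \<nu> x = 1} = A \<nu>"
      using clopenA[of \<nu>] openin_subset[of X "A \<nu>"] by (auto simp: e_def)
    then show "openin X {x \<in> topspace X. e \<nu> x = 1}"
      using clopenA by simp
  qed (auto simp: e_def)
  show "continuous_map ?Y (Ck X two) e"
    unfolding continuous_map_def
  proof (intro conjI allI impI)
    show "e \<in> topspace ?Y \<rightarrow> topspace (Ck X two)"
      using e_cfuns by simp
    fix W assume W: "openin (Ck X two) W"
    show "openin ?Y {\<nu> \<in> topspace ?Y. e \<nu> \<in> W}"
      unfolding openin_product_discrete_topology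
    proof (intro conjI ballI)
      fix \<nu> assume "\<nu> \<in> {\<nu> \<in> topspace ?Y. e \<nu> \<in> W}"
      then have "e \<nu> \<in> W" by blast
      then obtain K where K: "compactin X K" "\<forall>g\<in>cfuns X two. (\<forall>x\<in>K. g x = e \<nu> x) \<longrightarrow> g \<in> W"
        using W openin_Ck_two_iff[of X W] by blast
      \<comment> \<open>On \<open>K\<close> the indicator depends only on the exponents at those
        \<open>a\<close> for which \<open>V a 0\<close> meets \<open>K\<close>, and these are
        finitely many.\<close>
      have "e \<mu> \<in> W" if "\<forall>a\<in>{a \<in> E. V a 0 \<inter> K \<noteq> {}}. \<mu> a = \<nu> a" for \<mu>
      proof -
        have "x \<in> A \<mu> \<longleftrightarrow> x \<in> A \<nu>" if x: "x \<in> K" for x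
        proof -
          have "\<mu> a = \<nu> a" if "a \<in> E" "x \<in> V a 0" for a
            using that x \<open>\<forall>a\<in>{a \<in> E. V a 0 \<inter> K \<noteq> {}}. \<mu> a = \<nu> a\<close> by blast
          then show ?thesis
            unfolding A_def by (auto 4 3)
        qed
        then show ?thesis
          using K(2) e_cfuns[of \<mu>] by (simp add: e_def restrict_def)
      qed
      then show "\<exists>F. finite F \<and> F \<subseteq> E \<and> (\<forall>\<mu>\<in>E \<rightarrow>\<^sub>E UNIV. (\<forall>a\<in>F. \<mu> a = \<nu> a) \<longrightarrow>
          \<mu> \<in> {\<nu> \<in> topspace ?Y. e \<nu> \<in> W})"
        using compactin_meets_finite[OF K(1) lf]
        by (intro exI[of _ "{a \<in> E. V a 0 \<inter> K \<noteq> {}}"]) simp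
    qed simp
  qed
  show "continuous_map (Cp X two) ?Y r"
    unfolding continuous_map_componentwise
  proof (intro conjI ballI)
    show "r ` topspace (Cp X two) \<subseteq> extensional E"
      by (auto simp: r_def)
    fix a assume a: "a \<in> E"
    have "openin (Cp X two) {f \<in> cfuns X two. r f a \<in> W}" for W
      unfolding openin_Cp_two_iff
    proof (intro conjI ballI)
      fix f assume "f \<in> {f \<in> cfuns X two. r f a \<in> W}"
      then have f: "f \<in> cfuns X two" "r f a \<in> W" by auto
      have "a \<in> topspace X"
        using aV[OF a] topV[OF a] by blast
      \<comment> \<open>The fibre of \<open>f\<close> through \<open>a\<close> is an open
        neighbourhood of \<open>a\<close>, so the least index in the definition of \<open>r\<close>
        exists.\<close>
      then have "\<exists>n. p a n \<in> {x \<in> topspace X. f x = f a}"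
        using lim[OF a openin_cfuns_two_fibre[OF f(1)]] by simp
      then have "\<exists>n. f (p a n) = f a" by auto
      then have n: "f (p a (r f a)) = f a" "\<And>m. m < r f a \<Longrightarrow> f (p a m) \<noteq> f a"
        using a by (auto simp: r_def intro: LeastI_ex dest: not_less_Least)
      \<comment> \<open>The values at \<open>a\<close> and at the points \<open>p a m\<close> up to
        the least index fix that index, so each coordinate of \<open>r\<close> is locally
        constant.\<close>
      define F where "F = insert a (p a ` {..r f a})"
      have "r g a \<in> W" if "\<forall>x\<in>F. g x = f x" for g
      proof -
        have "(LEAST n. g (p a n) = g a) = r f a"
        proof (rule Least_equality)
          show "g (p a (r f a)) = g a"
            using that n(1) by (simp add: F_def)
          show "r f a \<le> m" if "g (p a m) = g a" for m
          proof (rule ccontr)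
            assume "\<not> r f a \<le> m"
            then have "g (p a m) = f (p a m)" "g a = f a" "f (p a m) \<noteq> f a"
              using \<open>\<forall>x\<in>F. g x = f x\<close> n(2) by (auto simp: F_def)
            then show False
              using that by simp
          qed
        qed
        then have "r g a = r f a"
          using a by (simp add: r_def)
        then show ?thesis
          using f(2) by simp
      qed
      moreover have "finite F" "F \<subseteq> topspace X"
        using \<open>a \<in> topspace X\<close> p[OF a] topV[OF a] by (auto simp: F_def)
      ultimately show "\<exists>F. finite F \<and> F \<subseteq> topspace X \<and> (\<forall>g\<in>cfuns X two. (\<forall>x\<in>F. g x = f x) \<longrightarrow>
          g \<in> {f \<in> cfuns X two. r f a \<in> W})"
        by (intro exI[of _ F]) simp
    qed blast
    then show "continuous_map (Cp X two) (discrete_topology UNIV) (\<lambda>f. r f a)"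
      by (simp add: continuous_map_def)
  qed
  show "\<forall>\<nu> \<in> topspace ?Y. r (e \<nu>) = \<nu>"
  proof
    fix \<nu> assume \<nu>: "\<nu> \<in> topspace ?Y"
    have "(LEAST n. e \<nu> (p a n) = e \<nu> a) = \<nu> a" if a: "a \<in> E" for a
    proof -
      have inA: "x \<in> A \<nu> \<longleftrightarrow> x \<notin> V a (\<nu> a)" if "x \<in> V a 0" for x
        using disj[OF a] that a unfolding A_def disjnt_iff by blast
      have "e \<nu> a = 0"
        using inA[of a] aV[OF a] topV[OF a] by (auto simp: e_def)
      \<comment> \<open>As \<open>p a n\<close> leaves the sequence exactly after
        \<open>V a n\<close>, it lies in \<open>V a (\<nu> a)\<close> precisely from
        \<open>n = \<nu> a\<close> on; there the indicator drops to its value 0 at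
        \<open>a\<close>.\<close>
      moreover have "e \<nu> (p a n) = 0 \<longleftrightarrow> \<nu> a \<le> n" for n
      proof -
        have "p a n \<in> V a 0" "p a n \<in> topspace X"
          using p[OF a, of n] dec[OF a, of 0 n] topV[OF a] by blast+
        moreover have "p a n \<in> V a (\<nu> a) \<longleftrightarrow> \<nu> a \<le> n"
        proof
          show "p a n \<in> V a (\<nu> a)" if "\<nu> a \<le> n"
            using p[OF a, of n] dec[OF a that] by blast
          show "\<nu> a \<le> n" if "p a n \<in> V a (\<nu> a)"
            using that p[OF a, of n] dec[OF a, of "Suc n" "\<nu> a"] by (metis DiffD2 not_less_eq_eq subsetD)
        qed
        ultimately show ?thesis
          using inA[of "p a n"] by (simp add: e_def)
      qed
      ultimately show ?thesis
        by (simp add: Least_equality)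
    qed
    then show "r (e \<nu>) = \<nu>"
      using \<nu> by (auto simp: r_def PiE_iff extensional_def fun_eq_iff)
  qed
qed

subsection \<open>Separability in metric spaces\<close>

context Metric_space
begin

text \<open>Zorn's lemma for the separated subsets of \<open>S\<close>: a point at distance at least
  \<open>\<epsilon>\<close> from all of a maximal one could be added to it.\<close>

lemma maximal_separated_subset:
  obtains E where "E \<subseteq> S" "\<And>a b. \<lbrakk>a \<in> E; b \<in> E; a \<noteq> b\<rbrakk> \<Longrightarrow> \<epsilon> \<le> d a b"
    and "\<And>x. x \<in> S - E \<Longrightarrow> \<exists>a\<in>E. d a x < \<epsilon>"
proof -
  define \<A> where "\<A> = {E. E \<subseteq> S \<and> (\<forall>a\<in>E. \<forall>b\<in>E. a \<noteq> b \<longrightarrow> \<epsilon> \<le> d a b)}"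
  have "\<exists>E\<in>\<A>. \<forall>F\<in>\<A>. E \<subseteq> F \<longrightarrow> F = E"
  proof (rule subset_Zorn')
    fix \<C> assume \<C>: "subset.chain \<A> \<C>"
    have "\<epsilon> \<le> d a b" if ab: "a \<in> \<Union>\<C>" "b \<in> \<Union>\<C>" "a \<noteq> b" for a b
    proof -
      obtain F G where FG: "F \<in> \<C>" "a \<in> F" "G \<in> \<C>" "b \<in> G"
        using ab(1,2) by (elim UnionE)
      then have "F \<subseteq> G \<or> G \<subseteq> F" "F \<in> \<A>" "G \<in> \<A>"
        using \<C> unfolding subset_chain_def by blast+
      then show ?thesis
        using FG \<open>a \<noteq> b\<close> unfolding \<A>_def by (elim disjE) (simp_all add: subset_iff)
    qed
    moreover have "\<Union>\<C> \<subseteq> S"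
      using \<C> unfolding subset_chain_def \<A>_def by blast
    ultimately show "\<Union>\<C> \<in> \<A>"
      unfolding \<A>_def by blast
  qed
  then obtain E where E: "E \<in> \<A>" and max: "\<forall>F\<in>\<A>. E \<subseteq> F \<longrightarrow> F = E"
    by (elim bexE)
  have "\<exists>a\<in>E. d a x < \<epsilon>" if "x \<in> S - E" for x
  proof (rule ccontr)
    assume "\<not> (\<exists>a\<in>E. d a x < \<epsilon>)"
    then have "\<forall>a\<in>E. \<epsilon> \<le> d a x" "\<forall>a\<in>E. \<epsilon> \<le> d x a"
      using commute by (simp_all add: not_less)
    then have "insert x E \<in> \<A>"
      using E that unfolding \<A>_def by auto
    then show False
      using max that by blast
  qed
  then show ?thesis
    using that[of E] E unfolding \<A>_def by blast
qed

text \<open>Maximal separated subsets for the scales \<open>inverse (Suc n)\<close> have a countable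
  dense union. Used in contrapositive form, to extract an uncountable uniformly separated
  set.\<close>

lemma separable_space_subtopology_if_separated_countable:
  assumes "S \<subseteq> M"
    and ctb: "\<And>\<epsilon> E. \<lbrakk>\<epsilon> > 0; E \<subseteq> S; \<And>a b. \<lbrakk>a \<in> E; b \<in> E; a \<noteq> b\<rbrakk> \<Longrightarrow> \<epsilon> \<le> d a b\<rbrakk> \<Longrightarrow> countable E"
  shows "separable_space (subtopology mtopology S)"
proof -
  have "\<exists>E. E \<subseteq> S \<and> countable E \<and> (\<forall>x\<in>S - E. \<exists>a\<in>E. d a x < inverse (Suc n))" for n
  proof -
    obtain E where E: "E \<subseteq> S" "\<And>a b. \<lbrakk>a \<in> E; b \<in> E; a \<noteq> b\<rbrakk> \<Longrightarrow> inverse (Suc n) \<le> d a b"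
      "\<And>x. x \<in> S - E \<Longrightarrow> \<exists>a\<in>E. d a x < inverse (Suc n)"
      by (rule maximal_separated_subset[of S "inverse (Suc n)"]) blast
    have "countable E"
      by (rule ctb[OF _ E(1,2)]) simp_all
    with E(1,3) show ?thesis
      by (intro exI[of _ E] conjI ballI)
  qed
  then obtain E where E: "\<And>n. E n \<subseteq> S" "\<And>n. countable (E n)"
    "\<And>n. \<forall>x\<in>S - E n. \<exists>a\<in>E n. d a x < inverse (Suc n)"
    by metis
  define C where "C = (\<Union>n. E n)"
  have "countable C" "C \<subseteq> S"
    using E by (auto simp: C_def)
  moreover have "x \<in> mtopology closure_of C" if x: "x \<in> S" for x
  proof -
    have "\<exists>y\<in>C. y \<in> mball x s" if "s > 0" for s
    proof -
      obtain n where n: "inverse (real (Suc n)) < s"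
        using reals_Archimedean[OF \<open>s > 0\<close>] by auto
      have "\<exists>y\<in>E n. d y x < s"
      proof (cases "x \<in> E n")
        case True
        then show ?thesis
          using \<open>s > 0\<close> x \<open>S \<subseteq> M\<close> by (intro bexI[of _ x]) auto
      next
        case False
        then show ?thesis
          using E(3)[of n] x n by force
      qed
      then show ?thesis
        using E(1)[of n] x \<open>S \<subseteq> M\<close> commute unfolding C_def by (auto simp: in_mball)
    qed
    then show ?thesis
      using x \<open>S \<subseteq> M\<close> by (auto simp: metric_closure_of)
  qed
  then have "subtopology mtopology S closure_of C = S"
    using \<open>C \<subseteq> S\<close> by (auto simp: closure_of_subtopology Int_absorb1)
  ultimately show ?thesis
    unfolding separable_space_def using \<open>S \<subseteq> M\<close> by (auto simp: Int_absorb1)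
qed

text \<open>Balls of the whole space, centred in a countable dense subset of \<open>S\<close>, with
  radii \<open>inverse (Suc n)\<close>. A radius below \<open>s / 2\<close> lets a ball around a
  nearby centre contain \<open>x\<close> and stay within distance \<open>s\<close> of it.\<close>

lemma separable_subspace_countable_outer_base:
  assumes "S \<subseteq> M" and sep: "separable_space (subtopology mtopology S)"
  obtains \<B> where "countable \<B>" "\<And>B. B \<in> \<B> \<Longrightarrow> openin mtopology B"
    "\<And>x U. \<lbrakk>x \<in> S; openin mtopology U; x \<in> U\<rbrakk> \<Longrightarrow> \<exists>B\<in>\<B>. x \<in> B \<and> B \<subseteq> U"
proof -
  have "topspace (subtopology mtopology S) = S"
    using \<open>S \<subseteq> M\<close> by (simp add: Int_absorb1)
  then obtain C where C: "countable C" "C \<subseteq> S" "subtopology mtopology S closure_of C = S"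
    using sep unfolding separable_space_def by (elim exE conjE) simp
  then have dense: "S \<subseteq> mtopology closure_of C"
    by (auto simp: closure_of_subtopology Int_absorb1)
  let ?\<B> = "(\<lambda>(c, n). mball c (inverse (real (Suc n)))) ` (C \<times> UNIV)"
  have "countable ?\<B>"
    using C(1) by simp
  moreover have "openin mtopology B" if "B \<in> ?\<B>" for B
    using that by (elim imageE) (simp add: case_prod_beta)
  moreover have "\<exists>B\<in>?\<B>. x \<in> B \<and> B \<subseteq> U" if x: "x \<in> S" "openin mtopology U" "x \<in> U" for x U
  proof -
    have "\<exists>s>0. mball x s \<subseteq> U"
      using x(2,3) by (simp add: openin_mtopology)
    then obtain s where s: "s > 0" "mball x s \<subseteq> U"
      by (elim exE conjE)
    obtain n where n: "inverse (real (Suc n)) < s / 2"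
      using reals_Archimedean[of "s / 2"] s(1) by auto
    have "x \<in> mtopology closure_of C" "0 < inverse (real (Suc n))"
      using dense x(1) by auto
    then obtain c where c: "c \<in> C" "c \<in> mball x (inverse (real (Suc n)))"
      unfolding metric_closure_of by blast
    have "x \<in> mball c (inverse (real (Suc n)))"
      using c(2) commute by (simp add: in_mball)
    moreover have "mball c (inverse (real (Suc n))) \<subseteq> mball x s"
    proof
      fix y assume "y \<in> mball c (inverse (real (Suc n)))"
      then show "y \<in> mball x s"
        using c(2) n triangle[of x c y] by (auto simp: in_mball)
    qed
    ultimately show ?thesis
      using c(1) s(2) by (intro bexI[of _ "mball c (inverse (real (Suc n)))"]) auto
  qed
  ultimately show ?thesis
    by (rule that)
qed

text \<open>Every neighbourhood of the non-isolated point \<open>a\<close> contains another point,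
  which can be left out when passing to the next clopen set; the omitted points serve as
  \<open>p n\<close>.\<close>

lemma clopen_shrinking_neighbourhoods:
  assumes zd: "zero_dimensional_space mtopology"
    and a: "a \<in> mtopology derived_set_of M" and "s > 0"
  obtains V p where "\<And>n. openin mtopology (V n)" "\<And>n. closedin mtopology (V n)"
    "\<And>m n :: nat. m \<le> n \<Longrightarrow> V n \<subseteq> V m" "\<And>n. a \<in> V n" "\<And>n. V n \<subseteq> mball a s"
    "\<And>n. p n \<in> V n - V (Suc n)"
    "\<And>W. \<lbrakk>openin mtopology W; a \<in> W\<rbrakk> \<Longrightarrow> \<exists>n. p n \<in> W"
proof -
  have clopen: "\<exists>B. openin mtopology B \<and> closedin mtopology B \<and> a \<in> B \<and> B \<subseteq> W"
    if "openin mtopology W" "a \<in> W" for W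
  proof -
    obtain \<B> where \<B>: "\<forall>B\<in>\<B>. openin mtopology B \<and> closedin mtopology B"
      "openin mtopology = arbitrary union_of (\<lambda>B. B \<in> \<B>)"
      using zd unfolding zero_dimensional_space_def by (elim exE conjE)
    have "(arbitrary union_of (\<lambda>B. B \<in> \<B>)) W"
      using that \<B>(2) by simp
    then show ?thesis
      using \<B>(1) \<open>a \<in> W\<close> unfolding union_of_def by blast
  qed
  have aM: "a \<in> M"
    using a derived_set_of_subset_topspace by fastforce
  \<comment> \<open>The radius \<open>s\<close> will keep different centres apart; the radius
    \<open>inverse (Suc n)\<close> makes the points \<open>p n\<close> converge to
    \<open>a\<close>.\<close>
  define good where "good n B \<longleftrightarrow> openin mtopology B \<and> closedin mtopology B \<and> a \<in> B \<and>
      B \<subseteq> mball a s \<and> B \<subseteq> mball a (inverse (real (Suc n)))" for n B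
  have ex: "\<exists>B. good n B \<and> B \<subseteq> W" if W: "openin mtopology W" "a \<in> W" for n W
    using clopen[of "W \<inter> (mball a s \<inter> mball a (inverse (real (Suc n))))"] W aM \<open>s > 0\<close>
    unfolding good_def by (auto simp: openin_Int)
  have "\<exists>V. \<forall>n. good n (V n) \<and> V (Suc n) \<subseteq> V n \<and> (\<exists>q. q \<in> V n - V (Suc n))"
  proof (rule dependent_nat_choice)
    show "\<exists>B. good 0 B"
      using ex[of M 0] aM by (metis openin_topspace topspace_mtopology)
    fix B n assume B: "good n B"
    then obtain q where q: "q \<in> B" "q \<noteq> a"
      using a unfolding derived_set_of_def good_def by blast
    have "openin mtopology (B - {q})" "a \<in> B - {q}"
      using B q unfolding good_def by (auto intro: t1_space_openin_delete_alt[THEN iffD1, OF t1_space_mtopology, rule_format])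
    then show "\<exists>B'. good (Suc n) B' \<and> B' \<subseteq> B \<and> (\<exists>q. q \<in> B - B')"
      using ex[of "B - {q}" "Suc n"] q by blast
  qed
  then obtain V where V: "\<And>n. good n (V n)" "\<And>n. V (Suc n) \<subseteq> V n" "\<And>n. \<exists>q. q \<in> V n - V (Suc n)"
    by (elim exE) blast
  then obtain p where p: "\<And>n. p n \<in> V n - V (Suc n)"
    by metis
  show ?thesis
  proof
    show "V n \<subseteq> V m" if "m \<le> n" for m n
      by (rule lift_Suc_antimono_le[of V, OF V(2) that])
    show "\<exists>n. p n \<in> W" if W: "openin mtopology W" "a \<in> W" for W
    proof -
      have "\<exists>s>0. mball a s \<subseteq> W"
        using W by (simp add: openin_mtopology)
      then obtain s where s: "s > 0" "mball a s \<subseteq> W"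
        by (elim exE conjE)
      obtain n where n: "inverse (real (Suc n)) < s"
        using reals_Archimedean[OF s(1)] by (elim exE)
      have "p n \<in> mball a (inverse (real (Suc n)))"
        using p[of n] V(1)[of n] unfolding good_def by blast
      then have "p n \<in> W"
        using n s(2) by (auto simp: in_mball)
      then show ?thesis ..
    qed
  qed (use V(1) p in \<open>auto simp: good_def\<close>)
qed

text \<open>Around the points of an uncountable \<open>\<epsilon>\<close>-separated subset of the
  derived set, shrinking clopen sets of radius \<open>\<epsilon> / 4\<close> form a disjoint,
  locally finite family.\<close>

lemma power_nat_retract_if_derived_set_nonseparable:
  assumes zd: "zero_dimensional_space mtopology"
    and nonsep: "\<not> separable_space (subtopology mtopology (mtopology derived_set_of M))"
  obtains E r e where "uncountable (E :: 'a set)"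
    "continuous_map (Cp mtopology two) (product_topology (\<lambda>_. discrete_topology (UNIV :: nat set)) E) r"
    "continuous_map (product_topology (\<lambda>_. discrete_topology (UNIV :: nat set)) E) (Ck mtopology two) e"
    "\<forall>\<nu> \<in> topspace (product_topology (\<lambda>_. discrete_topology (UNIV :: nat set)) E). r (e \<nu>) = \<nu>"
proof -
  let ?D = "mtopology derived_set_of M"
  have DM: "?D \<subseteq> M"
    by (metis derived_set_of_subset_topspace topspace_mtopology)
  obtain \<epsilon> E where E: "\<epsilon> > 0" "E \<subseteq> ?D" "\<And>a b. \<lbrakk>a \<in> E; b \<in> E; a \<noteq> b\<rbrakk> \<Longrightarrow> \<epsilon> \<le> d a b" "uncountable E"
    using separable_space_subtopology_if_separated_countable[OF DM] nonsep by metis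
  have "\<exists>V p. (\<forall>n. openin mtopology (V n) \<and> closedin mtopology (V n)) \<and>
    (\<forall>m n :: nat. m \<le> n \<longrightarrow> V n \<subseteq> V m) \<and> (\<forall>n. a \<in> V n) \<and> (\<forall>n. V n \<subseteq> mball a (\<epsilon> / 4)) \<and>
    (\<forall>n. p n \<in> V n - V (Suc n)) \<and> (\<forall>W. openin mtopology W \<longrightarrow> a \<in> W \<longrightarrow> (\<exists>n. p n \<in> W))"
    if "a \<in> E" for a
  proof -
    have "a \<in> ?D" "\<epsilon> / 4 > 0"
      using that E by auto
    from clopen_shrinking_neighbourhoods[OF zd this] obtain V p where
      "\<And>n. openin mtopology (V n)" "\<And>n. closedin mtopology (V n)"
      "\<And>m n :: nat. m \<le> n \<Longrightarrow> V n \<subseteq> V m" "\<And>n. a \<in> V n" "\<And>n. V n \<subseteq> mball a (\<epsilon> / 4)"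
      "\<And>n. p n \<in> V n - V (Suc n)" "\<And>W. \<lbrakk>openin mtopology W; a \<in> W\<rbrakk> \<Longrightarrow> \<exists>n. p n \<in> W"
      by blast
    then show ?thesis
      by (intro exI[of _ V] exI[of _ p] conjI allI impI)
  qed
  then have "\<forall>a\<in>E. \<exists>V p. (\<forall>n. openin mtopology (V n) \<and> closedin mtopology (V n)) \<and>
    (\<forall>m n :: nat. m \<le> n \<longrightarrow> V n \<subseteq> V m) \<and> (\<forall>n. a \<in> V n) \<and> (\<forall>n. V n \<subseteq> mball a (\<epsilon> / 4)) \<and>
    (\<forall>n. p n \<in> V n - V (Suc n)) \<and> (\<forall>W. openin mtopology W \<longrightarrow> a \<in> W \<longrightarrow> (\<exists>n. p n \<in> W))"
    by (rule ballI)
  from bchoice[OF this] obtain V where "\<forall>a\<in>E. \<exists>p. (\<forall>n. openin mtopology (V a n) \<and> closedin mtopology (V a n)) \<and>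
    (\<forall>m n :: nat. m \<le> n \<longrightarrow> V a n \<subseteq> V a m) \<and> (\<forall>n. a \<in> V a n) \<and> (\<forall>n. V a n \<subseteq> mball a (\<epsilon> / 4)) \<and>
    (\<forall>n. p n \<in> V a n - V a (Suc n)) \<and> (\<forall>W. openin mtopology W \<longrightarrow> a \<in> W \<longrightarrow> (\<exists>n. p n \<in> W))"
    by (elim exE)
  from bchoice[OF this] obtain p where Vp: "\<forall>a\<in>E. (\<forall>n. openin mtopology (V a n) \<and> closedin mtopology (V a n)) \<and>
    (\<forall>m n :: nat. m \<le> n \<longrightarrow> V a n \<subseteq> V a m) \<and> (\<forall>n. a \<in> V a n) \<and> (\<forall>n. V a n \<subseteq> mball a (\<epsilon> / 4)) \<and>
    (\<forall>n. p a n \<in> V a n - V a (Suc n)) \<and> (\<forall>W. openin mtopology W \<longrightarrow> a \<in> W \<longrightarrow> (\<exists>n. p a n \<in> W))"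
    by (elim exE)
  have close: "d a x < \<epsilon> / 4 \<and> a \<in> M \<and> x \<in> M" if "a \<in> E" "x \<in> V a 0" for a x
  proof -
    have "V a 0 \<subseteq> mball a (\<epsilon> / 4)"
      using bspec[OF Vp that(1)] by (elim conjE) (erule spec)
    then have "x \<in> mball a (\<epsilon> / 4)"
      using that(2) by (rule subsetD)
    then show ?thesis
      by simp
  qed
  \<comment> \<open>The path from \<open>a\<close> over \<open>x\<close>, \<open>z\<close>,
    \<open>y\<close> to \<open>b\<close> has four steps shorter than \<open>\<epsilon> / 4\<close>.
    With \<open>x = y = z\<close> this gives disjointness; in general a ball of radius
    \<open>\<epsilon> / 4\<close> meets at most one \<open>V a 0\<close>.\<close>
  have one: "a = b" if "a \<in> E" "b \<in> E" "x \<in> V a 0" "y \<in> V b 0" "d z x < \<epsilon> / 4" "d z y < \<epsilon> / 4" "z \<in> M" for a b x y z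
  proof (rule ccontr)
    assume "a \<noteq> b"
    then have "\<epsilon> \<le> d a b"
      using E(3) that by blast
    moreover have "d a b \<le> d a x + d x z + d z y + d y b"
      using close[OF that(1,3)] close[OF that(2,4)] \<open>z \<in> M\<close>
        triangle[of a x b] triangle[of x z b] triangle[of z y b] by auto
    ultimately show False
      using close[OF that(1,3)] close[OF that(2,4)] that(5,6) commute[of x z] commute[of y b] by linarith
  qed
  show ?thesis
  proof (rule power_nat_retract_of_cfuns_two[of E mtopology V p])
    show "disjnt (V a 0) (V b 0)" if "a \<in> E" "b \<in> E" "a \<noteq> b" for a b
    proof (rule ccontr)
      assume "\<not> disjnt (V a 0) (V b 0)"
      then obtain x where x: "x \<in> V a 0" "x \<in> V b 0"
        by (auto simp: disjnt_iff)
      moreover have "x \<in> M" "d x x < \<epsilon> / 4"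
        using close[OF \<open>a \<in> E\<close> x(1)] E(1) by auto
      ultimately show False
        using one[of a b x x x] that by blast
    qed
    show "\<exists>W. openin mtopology W \<and> z \<in> W \<and> finite {a \<in> E. V a 0 \<inter> W \<noteq> {}}" if "z \<in> topspace mtopology" for z
    proof (intro exI conjI)
      show "openin mtopology (mball z (\<epsilon> / 4))" "z \<in> mball z (\<epsilon> / 4)"
        using that E(1) by auto
      have "a = b" if ab: "a \<in> {a \<in> E. V a 0 \<inter> mball z (\<epsilon> / 4) \<noteq> {}}" "b \<in> {a \<in> E. V a 0 \<inter> mball z (\<epsilon> / 4) \<noteq> {}}" for a b
      proof -
        obtain x where "x \<in> V a 0" "x \<in> mball z (\<epsilon> / 4)"
          using ab(1) by blast
        moreover obtain y where "y \<in> V b 0" "y \<in> mball z (\<epsilon> / 4)"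
          using ab(2) by blast
        ultimately show ?thesis
          using one[of a b x y z] ab by auto
      qed
      then show "finite {a \<in> E. V a 0 \<inter> mball z (\<epsilon> / 4) \<noteq> {}}"
        by (metis (no_types, lifting) finite.simps subset_singletonD subsetI singletonI all_not_in_conv)
    qed
  qed (use Vp that[OF E(4)] in \<open>auto\<close>)
qed

end

section \<open>From normality back to separability, and the equivalence\<close>

text \<open>The map \<open>r\<close> is continuous on the coarser space and \<open>e\<close> into
  the finer one; composing with the identity from \<open>Ck\<close> to \<open>Cp\<close> makes
  \<open>r\<close> a retraction from either space, and normality passes to retracts.\<close>

lemma normal_spaces_imp_separable_derived_set:
  fixes M :: "'a set" and d :: "'a \<Rightarrow> 'a \<Rightarrow> real" and X :: "'a topology"
  assumes "Metric_space M d" and "X = Metric_space.mtopology M d" and "zero_dimensional_space X"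
    and "normal_space (Ck X two) \<or> normal_space (Cp X two)"
  shows "separable_space (subtopology X (X derived_set_of (topspace X)))"
proof (rule ccontr)
  interpret Metric_space M d by fact
  assume "\<not> separable_space (subtopology X (X derived_set_of (topspace X)))"
  then have nonsep: "\<not> separable_space (subtopology mtopology (mtopology derived_set_of M))"
    by (simp add: assms(2))
  obtain E r e where E: "uncountable (E :: 'a set)"
    and r: "continuous_map (Cp X two) (product_topology (\<lambda>_. discrete_topology (UNIV :: nat set)) E) r"
    and e: "continuous_map (product_topology (\<lambda>_. discrete_topology (UNIV :: nat set)) E) (Ck X two) e"
    and re: "\<forall>\<nu> \<in> topspace (product_topology (\<lambda>_. discrete_topology (UNIV :: nat set)) E). r (e \<nu>) = \<nu>"
    unfolding assms(2)
    by (rule power_nat_retract_if_derived_set_nonseparable[OF assms(3)[unfolded assms(2)] nonsep]) blast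
  have "continuous_map (Ck X two) (product_topology (\<lambda>_. discrete_topology (UNIV :: nat set)) E) r"
    using continuous_map_compose[OF continuous_map_Ck_Cp r] by (simp add: comp_def)
  then have "retraction_map (Ck X two) (product_topology (\<lambda>_. discrete_topology (UNIV :: nat set)) E) r"
    using e re unfolding retraction_map_def retraction_maps_def by blast
  moreover have "continuous_map (product_topology (\<lambda>_. discrete_topology (UNIV :: nat set)) E) (Cp X two) e"
    using continuous_map_compose[OF e continuous_map_Ck_Cp] by (simp add: comp_def)
  then have "retraction_map (Cp X two) (product_topology (\<lambda>_. discrete_topology (UNIV :: nat set)) E) r"
    using r re unfolding retraction_map_def retraction_maps_def by blast
  ultimately show False
    using not_normal_space_uncountable_power_nat[OF E] assms(4) normal_space_retraction_map_image by blast
qed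

theorem theorem1p6:
  fixes M :: "'a set" and d :: "'a \<Rightarrow> 'a \<Rightarrow> real" and X :: "'a topology"
  assumes "Metric_space M d"
    and "X = Metric_space.mtopology M d"
    and "zero_dimensional_space X"
  shows "(normal_space (Ck X two) \<longleftrightarrow> normal_space (Cp X two)) \<and>
         (normal_space (Cp X two) \<longleftrightarrow> Lindelof_space (Ck X two)) \<and>
         (Lindelof_space (Ck X two) \<longleftrightarrow>
            separable_space (subtopology X (X derived_set_of (topspace X))))"
proof -
  interpret Metric_space M d by fact
  have Lindelof: "Lindelof_space (Ck X two)"
    if sep: "separable_space (subtopology X (X derived_set_of (topspace X)))"
  proof -
    have DM: "X derived_set_of (topspace X) \<subseteq> M"
      by (metis assms(2) derived_set_of_subset_topspace topspace_mtopology)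
    obtain \<B> where "countable \<B>" "\<And>B. B \<in> \<B> \<Longrightarrow> openin X B"
      "\<And>x U. \<lbrakk>x \<in> X derived_set_of (topspace X); openin X U; x \<in> U\<rbrakk> \<Longrightarrow> \<exists>B\<in>\<B>. x \<in> B \<and> B \<subseteq> U"
      by (rule separable_subspace_countable_outer_base[folded assms(2), OF DM sep]) blast
    then show ?thesis
      by (rule Lindelof_space_Ck_two)
  qed
  have normal_Ck: "normal_space (Ck X two)" if "Lindelof_space (Ck X two)"
    using that regular_space_Ck_two regular_Lindelof_imp_normal_space by blast
  have normal_Cp: "normal_space (Cp X two)" if "Lindelof_space (Ck X two)"
  proof -
    have "Lindelof_space (Cp X two)"
      by (rule Lindelof_space_continuous_map_image[OF that continuous_map_Ck_Cp]) simp
    then show ?thesis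
      using regular_space_Cp_two regular_Lindelof_imp_normal_space by blast
  qed
  \<comment> \<open>The cycle closes: separability gives the Lindelof property, this gives normality
    of both spaces, and normality of either gives separability.\<close>
  show ?thesis
    using Lindelof normal_Ck normal_Cp normal_spaces_imp_separable_derived_set[OF assms] by blast
qed

end
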